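(* Let $(G,H,\mathcal{L})$ be a cut and project scheme, $W\subset H$ compact, and let $$\mu:=\sum_{x\in\curlywedge(W)}\omega_x\delta_x$$ be a weakly almost periodic measure on $G$, with Eberlein decomposition $\mu=\mu_{\mathsf{s}}+\mu_0$. Then there exists some $(s,t)\in G\times H$ such that $$\operatorname{supp}(\mu_{\mathsf{s}})\subset s+\curlywedge(t+W)\quad\text{and}\quad\operatorname{supp}(\mu_0)\subset\big(s+\curlywedge(t+W)\big)\cup\curlywedge(W).$$
   Context: A cut and project scheme $(G,H,\mathcal{L})$ consists of two locally compact abelian groups $G,H$ and a lattice (discrete cocompact subgroup) $\mathcal{L}\subset G\times H$ such that the first projection $\pi_G:G\times H\to G$ restricted to $\mathcal{L}$ is one-to-one and the second projection $\pi_H:G\times H\to H$ has $\pi_H(\mathcal{L})$ dense in $H$. For pre-compact $W\subset H$, $\curlywedge(W):=\{x\in G:\text{ there is }y\in W\text{ with }(x,y)\in\mathcal{L}\}$, a uniformly discrete subset of $G$. The $\omega_x$ are complex numbers, $\delta_x$ unit point masses. $C_c(G)$: continuous compactly supported functions on $G$; $C_u(G)$: Banach space of bounded uniformly continuous complex functions, sup norm. $\theta_G$ (also $dt$) is Haar measure. Measures are (complex) Radon measures on $G$. $\mu$ is translation bounded if $\sup_{x\in G}|\mu|(x+K)<\infty$ for all compact $K$ ($|\mu|$ the variation). $(c*\mu)(x)=\int_G c(x-t)\,d\mu(t)$; $T^tf(x)=f(x-t)$. $f\in C_u(G)$ is Bohr (resp. weakly) almost periodic if $\{T^tf:t\in G\}$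 is precompact in the norm (resp. weak) topology of $C_u(G)$. $G$ is assumed to admit Følner sequences: sequences $(A_n)$ of compact sets of positive measure with $\theta_G(A_n\triangle(x+A_n))/\theta_G(A_n)\to0$ for all $x\in G$. Every weakly almost periodic $f$ has a mean $M(f)=\lim_n\frac1{\theta_G(A_n)}\int_{x+A_n}f(t)\,dt$, uniformly in $x\in G$, independent of the Følner sequence; $f$ is null weakly almost periodic if moreover $M(|f|)=0$. A translation bounded measure $\mu$ is strongly, weakly, resp. null weakly almost periodic ($\mu\in\mathcal{SAP}(G)$, $\mathcal{WAP}(G)$, $\mathcal{WAP}_0(G)$) if for all $c\in C_c(G)$ the function $c*\mu$ is Bohr, weakly, resp. null weakly almost periodic. One has $\mathcal{WAP}(G)=\mathcal{SAP}(G)\oplus\mathcal{WAP}_0(G)$; the Eberlein decomposition of $\mu\in\mathcal{WAP}(G)$ is the unique decomposition $\mu=\mu_{\mathsf{s}}+\mu_0$ with $\mu_{\mathsf{s}}\in\mathcal{SAP}(G)$, $\mu_0\in\mathcal{WAP}_0(G)$. *)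

theory Defs
  imports "HOL-Analysis.Analysis"
begin

text \<open>Locally compact abelian groups are types of sort \<open>{topological_ab_group_add, t2_space}\<close>
  whose topology is locally compact; the groups are written additively.\<close>


section \<open>Cut and project schemes\<close>

definition coset_rel :: "'a::ab_group_add set \<Rightarrow> ('a \<times> 'a) set" where
  "coset_rel L = {(a, b). a - b \<in> L}"

definition quotient_topology :: "('a::topological_space \<times> 'a) set \<Rightarrow> 'a set topology" where
  "quotient_topology R = topology (\<lambda>U. U \<subseteq> UNIV // R \<and> open {a. R `` {a} \<in> U})"

lemma openin_quotient_topology:
  "openin (quotient_topology R) U \<longleftrightarrow> U \<subseteq> UNIV // R \<and> open {a. R `` {a} \<in> U}"
proof -
  have "istopology (\<lambda>U. U \<subseteq> UNIV // R \<and> open {a. R `` {a} \<in> U})"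
    unfolding istopology_def
  proof (intro conjI allI impI)
    fix S T assume "S \<subseteq> UNIV // R \<and> open {a. R `` {a} \<in> S}" "T \<subseteq> UNIV // R \<and> open {a. R `` {a} \<in> T}"
    then show "S \<inter> T \<subseteq> UNIV // R" "open {a. R `` {a} \<in> S \<inter> T}"
      by (auto simp: Collect_conj_eq intro: open_Int)
  next
    fix \<K> assume *: "\<forall>K\<in>\<K>. K \<subseteq> UNIV // R \<and> open {a. R `` {a} \<in> K}"
    then show "\<Union>\<K> \<subseteq> UNIV // R"
      by blast
    have "{a. R `` {a} \<in> \<Union>\<K>} = (\<Union>K\<in>\<K>. {a. R `` {a} \<in> K})"
      by auto
    with * show "open {a. R `` {a} \<in> \<Union>\<K>}"
      by (simp add: open_UN)
  qed
  then show ?thesis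
    by (simp add: quotient_topology_def)
qed

lemma topspace_quotient_topology: "topspace (quotient_topology R) = UNIV // R"
proof -
  have "{a. R `` {a} \<in> UNIV // R} = UNIV"
    by (auto simp: quotient_def)
  then have "openin (quotient_topology R) (UNIV // R)"
    by (simp add: openin_quotient_topology)
  then show ?thesis
    by (auto simp: topspace_def openin_quotient_topology)
qed

lemma quotient_map_quotient_topology:
  "quotient_map euclidean (quotient_topology R) (\<lambda>a. R `` {a})"
  by (auto simp: quotient_map_def topspace_quotient_topology openin_quotient_topology quotient_def)

definition lattice_subgroup :: "'a::{ab_group_add, topological_space} set \<Rightarrow> bool" where
  "lattice_subgroup L \<longleftrightarrow>
     0 \<in> L \<and> (\<forall>a\<in>L. \<forall>b\<in>L. a + b \<in> L) \<and> (\<forall>a\<in>L. - a \<in> L) \<and>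
     discrete L \<and> compact_space (quotient_topology (coset_rel L))"

definition cut_and_project_scheme ::
  "('g::{topological_ab_group_add, t2_space} \<times> 'h::{topological_ab_group_add, t2_space}) set \<Rightarrow> bool"
  where
  "cut_and_project_scheme L \<longleftrightarrow>
     locally_compact_space (euclidean :: 'g topology) \<and>
     locally_compact_space (euclidean :: 'h topology) \<and>
     lattice_subgroup L \<and> inj_on fst L \<and> closure (snd ` L) = UNIV"

text \<open>The set written with a curly wedge in the literature on model sets.\<close>

definition cps_set :: "('g \<times> 'h) set \<Rightarrow> 'h set \<Rightarrow> 'g set" where
  "cps_set L W = {x. \<exists>y\<in>W. (x, y) \<in> L}"


section \<open>Measures as functionals\<close>

text \<open>A complex Radon measure need not be a complex measure on the Borel sets: its total variation
  may be infinite. It is represented by the functional \<open>f \<mapsto> \<integral> f d\<mu>\<close>, of which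
  only the values on compactly supported continuous functions are relevant; two functionals are the
  same measure if they agree on those.\<close>

type_synonym 'g msr = "('g \<Rightarrow> complex) \<Rightarrow> complex"

definition csupp :: "('g::topological_space \<Rightarrow> 'b::zero) \<Rightarrow> 'g set" where
  "csupp f = closure {x. f x \<noteq> 0}"

definition Cc :: "('g::topological_space \<Rightarrow> 'b::{zero, topological_space}) set" where
  "Cc = {f. continuous_on UNIV f \<and> compact (csupp f)}"

definition radon_measure :: "'g::topological_space msr \<Rightarrow> bool" where
  "radon_measure \<mu> \<longleftrightarrow>
     (\<forall>f\<in>Cc. \<forall>g\<in>Cc. \<mu> (\<lambda>x. f x + g x) = \<mu> f + \<mu> g) \<and>
     (\<forall>c. \<forall>f\<in>Cc. \<mu> (\<lambda>x. c * f x) = c * \<mu> f) \<and>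
     (\<forall>K. compact K \<longrightarrow>
        (\<exists>C. \<forall>f\<in>Cc. csupp f \<subseteq> K \<longrightarrow> norm (\<mu> f) \<le> C * (SUP x. norm (f x))))"

definition supp_measure :: "'g::topological_space msr \<Rightarrow> 'g set" where
  "supp_measure \<mu> = - \<Union>{U. open U \<and> (\<forall>f\<in>Cc. csupp f \<subseteq> U \<longrightarrow> \<mu> f = 0)}"

text \<open>The variation as a positive functional, and its value on compact sets (the usual formula of
  the Riesz representation theorem).\<close>

definition variation_fun :: "'g::topological_space msr \<Rightarrow> ('g \<Rightarrow> real) \<Rightarrow> real" where
  "variation_fun \<mu> f = (SUP g\<in>{g\<in>Cc. \<forall>x. norm (g x) \<le> f x}. norm (\<mu> g))"

definition variation_compact :: "'g::topological_space msr \<Rightarrow> 'g set \<Rightarrow> real" where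
  "variation_compact \<mu> K =
     (INF f\<in>{f\<in>Cc. (\<forall>x. 0 \<le> f x) \<and> (\<forall>x\<in>K. 1 \<le> f x)}. variation_fun \<mu> f)"

definition translation_bounded :: "'g::{topological_space, plus} msr \<Rightarrow> bool" where
  "translation_bounded \<mu> \<longleftrightarrow>
     (\<forall>K. compact K \<longrightarrow> bdd_above (range (\<lambda>x. variation_compact \<mu> ((+) x ` K))))"

definition conv_measure :: "('g::minus \<Rightarrow> complex) \<Rightarrow> 'g msr \<Rightarrow> 'g \<Rightarrow> complex" where
  "conv_measure c \<mu> = (\<lambda>x. \<mu> (\<lambda>t. c (x - t)))"

text \<open>For \<open>S\<close> locally finite and \<open>f\<close> compactly supported, only finitely many terms are nonzero.\<close>

definition weighted_dirac_comb :: "('g \<Rightarrow> complex) \<Rightarrow> 'g set \<Rightarrow> 'g msr" where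
  "weighted_dirac_comb \<omega> S = (\<lambda>f. \<Sum>\<^sub>\<infinity>x\<in>S. \<omega> x * f x)"


section \<open>Haar measure, Folner sequences and means\<close>

definition haar_measure :: "'g::{topological_ab_group_add, t2_space} measure \<Rightarrow> bool" where
  "haar_measure \<theta> \<longleftrightarrow>
     sets \<theta> = sets borel \<and>
     (\<forall>x. \<forall>B\<in>sets borel. emeasure \<theta> ((+) x ` B) = emeasure \<theta> B) \<and>
     (\<forall>K. compact K \<longrightarrow> emeasure \<theta> K < \<infinity>) \<and>
     (\<forall>U. open U \<and> U \<noteq> {} \<longrightarrow> emeasure \<theta> U > 0) \<and>
     (\<forall>B\<in>sets borel. emeasure \<theta> B = (INF U\<in>{U. open U \<and> B \<subseteq> U}. emeasure \<theta> U)) \<and>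
     (\<forall>U. open U \<longrightarrow> emeasure \<theta> U = (SUP K\<in>{K. compact K \<and> K \<subseteq> U}. emeasure \<theta> K))"

definition folner_sequence ::
  "'g::{topological_ab_group_add, t2_space} measure \<Rightarrow> (nat \<Rightarrow> 'g set) \<Rightarrow> bool" where
  "folner_sequence \<theta> A \<longleftrightarrow>
     (\<forall>n. compact (A n) \<and> measure \<theta> (A n) > 0) \<and>
     (\<forall>x. (\<lambda>n. measure \<theta> (sym_diff (A n) ((+) x ` A n)) / measure \<theta> (A n)) \<longlonglongrightarrow> 0)"

definition has_mean ::
  "'g::{topological_ab_group_add, t2_space} measure \<Rightarrow>
     ('g \<Rightarrow> 'b::{banach, second_countable_topology}) \<Rightarrow> 'b \<Rightarrow> bool" where
  "has_mean \<theta> f m \<longleftrightarrow>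
     (\<forall>A. folner_sequence \<theta> A \<longrightarrow>
        uniform_limit UNIV (\<lambda>n x. (LINT t:((+) x ` A n)|\<theta>. f t) /\<^sub>R measure \<theta> (A n))
          (\<lambda>_. m) sequentially)"


section \<open>Almost periodic functions\<close>

text \<open>The space of bounded functions that are uniformly continuous for the group uniformity, as a
  subspace of the bounded continuous functions with the supremum norm.\<close>

definition Cu :: "('g::topological_ab_group_add \<Rightarrow>\<^sub>C complex) set" where
  "Cu = {F. \<forall>e>0. \<forall>\<^sub>F y in nhds 0. \<forall>x. norm (apply_bcontfun F (x + y) - apply_bcontfun F x) < e}"

text \<open>The continuous complex-linear functionals on \<open>Cu\<close>; values outside \<open>Cu\<close> are irrelevant.\<close>

definition Cu_dual :: "(('g::topological_ab_group_add \<Rightarrow>\<^sub>C complex) \<Rightarrow> complex) set" where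
  "Cu_dual = {\<phi>.
     (\<forall>F\<in>Cu. \<forall>G\<in>Cu. \<phi> (F + G) = \<phi> F + \<phi> G) \<and>
     (\<forall>c. \<forall>F\<in>Cu. \<forall>G\<in>Cu. (\<forall>x. apply_bcontfun G x = c * apply_bcontfun F x) \<longrightarrow> \<phi> G = c * \<phi> F) \<and>
     (\<exists>B. \<forall>F\<in>Cu. norm (\<phi> F) \<le> B * norm F)}"

definition Cu_norm_topology :: "('g::topological_ab_group_add \<Rightarrow>\<^sub>C complex) topology" where
  "Cu_norm_topology = top_of_set Cu"

definition Cu_weak_topology :: "('g::topological_ab_group_add \<Rightarrow>\<^sub>C complex) topology" where
  "Cu_weak_topology =
     topology_generated_by {{F\<in>Cu. \<phi> F \<in> U} | \<phi> U. \<phi> \<in> Cu_dual \<and> open U}"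

definition translate :: "'g::minus \<Rightarrow> ('g \<Rightarrow> 'b) \<Rightarrow> 'g \<Rightarrow> 'b" where
  "translate t f = (\<lambda>x. f (x - t))"

definition translates :: "('g::topological_ab_group_add \<Rightarrow> complex) \<Rightarrow> ('g \<Rightarrow>\<^sub>C complex) set" where
  "translates f = {F. \<exists>t. apply_bcontfun F = translate t f}"

text \<open>Precompact in the sense of having compact closure.\<close>

definition precompact_in :: "'a topology \<Rightarrow> 'a set \<Rightarrow> bool" where
  "precompact_in X S \<longleftrightarrow> compactin X (X closure_of S)"

definition bohr_ap :: "('g::topological_ab_group_add \<Rightarrow> complex) \<Rightarrow> bool" where
  "bohr_ap f \<longleftrightarrow> f \<in> apply_bcontfun ` Cu \<and> precompact_in Cu_norm_topology (translates f)"

definition weakly_ap :: "('g::topological_ab_group_add \<Rightarrow> complex) \<Rightarrow> bool" where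
  "weakly_ap f \<longleftrightarrow> f \<in> apply_bcontfun ` Cu \<and> precompact_in Cu_weak_topology (translates f)"

definition null_weakly_ap ::
  "'g::{topological_ab_group_add, t2_space} measure \<Rightarrow> ('g \<Rightarrow> complex) \<Rightarrow> bool" where
  "null_weakly_ap \<theta> f \<longleftrightarrow> weakly_ap f \<and> has_mean \<theta> (\<lambda>x. norm (f x)) 0"


section \<open>Almost periodic measures\<close>

definition SAP :: "'g::topological_ab_group_add msr set" where
  "SAP = {\<mu>. radon_measure \<mu> \<and> translation_bounded \<mu> \<and> (\<forall>c\<in>Cc. bohr_ap (conv_measure c \<mu>))}"

definition WAP :: "'g::topological_ab_group_add msr set" where
  "WAP = {\<mu>. radon_measure \<mu> \<and> translation_bounded \<mu> \<and> (\<forall>c\<in>Cc. weakly_ap (conv_measure c \<mu>))}"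

definition WAP0 :: "'g::{topological_ab_group_add, t2_space} measure \<Rightarrow> 'g msr set" where
  "WAP0 \<theta> = {\<mu>. radon_measure \<mu> \<and> translation_bounded \<mu> \<and>
     (\<forall>c\<in>Cc. null_weakly_ap \<theta> (conv_measure c \<mu>))}"

definition eberlein_decomposition ::
  "'g::{topological_ab_group_add, t2_space} measure \<Rightarrow> 'g msr \<Rightarrow> 'g msr \<Rightarrow> 'g msr \<Rightarrow> bool" where
  "eberlein_decomposition \<theta> \<mu> \<mu>s \<mu>0 \<longleftrightarrow>
     \<mu>s \<in> SAP \<and> \<mu>0 \<in> WAP0 \<theta> \<and> (\<forall>f\<in>Cc. \<mu> f = \<mu>s f + \<mu>0 f)"

end

theory Submission
  imports Defs
begin

text \<open>
  Some net of translates of \<open>\<mu>\<close> converges vaguely to \<open>\<mu>\<^sub>s\<close>: given finitely many test functions, the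
  common almost periods of the corresponding convolutions with \<open>\<mu>\<^sub>s\<close> are syndetic, so the
  convolutions with \<open>\<mu>\<^sub>0\<close>, whose absolute values have mean zero, cannot stay away from zero on all
  of them. In the compact group \<open>(G \<times> H) / L\<close> the translation parameters \<open>(u, 0)\<close> of that net
  cluster at the class of some \<open>(a, b)\<close>; since \<open>L\<close> is closed and \<open>W\<close> is compact, the vague limit then
  lives on \<open>a + \<curlywedge>(W - b)\<close>. The claim on \<open>\<mu>\<^sub>0 = \<mu> - \<mu>\<^sub>s\<close> follows because \<open>\<curlywedge>(W)\<close> is closed.
\<close>

section \<open>Products of topological groups\<close>

text \<open>These instances make \<open>'g \<times> 'h\<close> a topological abelian group, so that
  results about a subgroup of one group apply to the lattice.\<close>

instance prod :: (topological_monoid_add, topological_monoid_add) topological_monoid_add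
proof
  fix a b :: "'a \<times> 'b"
  have "(fst \<longlongrightarrow> a) (nhds (a, b))" "(snd \<longlongrightarrow> b) (nhds (a, b))"
    using tendsto_fst[OF filterlim_ident, of "(a, b)"] tendsto_snd[OF filterlim_ident, of "(a, b)"]
    by simp_all
  then have "((\<lambda>x. (fst (fst x) + fst (snd x), snd (fst x) + snd (snd x)))
      \<longlongrightarrow> (fst a + fst b, snd a + snd b)) (nhds (a, b))"
    by (intro tendsto_Pair tendsto_add tendsto_fst tendsto_snd)
  then have "((\<lambda>x. fst x + snd x) \<longlongrightarrow> a + b) (nhds (a, b))"
    by (simp add: plus_prod_def)
  then show "((\<lambda>x. fst x + snd x) \<longlongrightarrow> a + b) (nhds a \<times>\<^sub>F nhds b)"
    by (simp add: nhds_prod)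
qed

instance prod :: (topological_comm_monoid_add, topological_comm_monoid_add) topological_comm_monoid_add ..

instance prod :: (topological_group_add, topological_group_add) topological_group_add
proof
  fix a :: "'a \<times> 'b"
  have "((\<lambda>x. (- fst x, - snd x)) \<longlongrightarrow> (- fst a, - snd a)) (nhds a)"
    by (intro tendsto_Pair tendsto_minus tendsto_fst tendsto_snd filterlim_ident)
  moreover have "uminus = (\<lambda>x::'a \<times> 'b. (- fst x, - snd x))"
    by (simp add: fun_eq_iff uminus_prod_def)
  ultimately show "(uminus \<longlongrightarrow> - a) (nhds a)"
    unfolding uminus_prod_def[of a] by simp
qed

instance prod :: (topological_ab_group_add, topological_ab_group_add) topological_ab_group_add ..

section \<open>Lattices and cocompactness\<close>

text \<open>Discreteness gives a neighbourhood \<open>N\<close> of 0 that meets \<open>L\<close>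
  only in 0. Two distinct points of \<open>L\<close> close to an accumulation point would have a
  nonzero difference in \<open>N\<close>.\<close>

lemma closed_discrete_subgroup:
  fixes L :: "'a::{topological_ab_group_add, t2_space} set"
  assumes "lattice_subgroup L"
  shows "closed L"
proof -
  have L: "0 \<in> L" "\<And>a b. a \<in> L \<Longrightarrow> b \<in> L \<Longrightarrow> a - b \<in> L" "discrete L"
    using assms unfolding lattice_subgroup_def
    by (auto simp: diff_conv_add_uminus simp del: add_uminus_conv_diff)
  obtain N where N: "open N" "N \<inter> L = {0}"
    using L unfolding discrete_def isolated_in_def by blast
  define D where "D = (\<lambda>p::'a \<times> 'a. fst p - snd p) -` N"
  have "open D"
    unfolding D_def using N(1) by (intro open_vimage continuous_intros)
  have "\<not> z islimpt L" for z
  proof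
    assume z: "z islimpt L"
    have "(z, z) \<in> D"
      using N by (auto simp: D_def)
    then obtain A B where AB: "open A" "open B" "(z, z) \<in> A \<times> B" "A \<times> B \<subseteq> D"
      using open_prod_elim[OF \<open>open D\<close>] by blast
    obtain l where l: "l \<in> L" "l \<in> A \<inter> B" "l \<noteq> z"
      using AB by (auto intro: islimptE[OF z, of "A \<inter> B"])
    \<comment> \<open>Removing \<open>l\<close> leaves a neighbourhood of \<open>z\<close>, since
      \<open>l\<close> differs from \<open>z\<close> and points are closed; this forces
      \<open>l - l'\<close> to be nonzero.\<close>
    obtain l' where l': "l' \<in> L" "l' \<in> A \<inter> B - {l}" "l' \<noteq> z"
    proof (rule islimptE[OF z, of "A \<inter> B - {l}"])
      show "open (A \<inter> B - {l})"
        using AB by (intro open_delete open_Int)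
    qed (use AB l in auto)
    have "l - l' \<in> N \<inter> L"
      using l l' AB(4) L(2) by (auto simp: D_def)
    with N l l' show False
      by auto
  qed
  then show ?thesis
    by (simp add: closed_limpt)
qed

text \<open>Compactness of the quotient, phrased with the finite intersection property in place of
  nets: the sets \<open>T i\<close> have a common cluster point modulo \<open>L\<close>. Otherwise
  every \<open>p\<close> has a neighbourhood whose translates by \<open>L\<close> miss some
  \<open>T i\<close>, and finitely many of these neighbourhoods cover the quotient.\<close>

lemma cocompact_cluster_point:
  fixes L :: "'a::topological_ab_group_add set"
  assumes "lattice_subgroup L"
    and fip: "\<And>J. finite J \<Longrightarrow> J \<subseteq> I \<Longrightarrow> (\<Inter>j\<in>J. T j) \<noteq> {}"
  obtains p where "\<And>i U. i \<in> I \<Longrightarrow> open U \<Longrightarrow> p \<in> U \<Longrightarrow> \<exists>u\<in>T i. \<exists>l\<in>L. u + l \<in> U"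
proof (rule ccontr)
  assume "\<not> thesis"
  with that have "\<forall>p. \<exists>i U. i \<in> I \<and> open U \<and> p \<in> U \<and> (\<forall>u\<in>T i. \<forall>l\<in>L. u + l \<notin> U)"
    by metis
  then obtain i U where iU: "\<And>p. i p \<in> I" "\<And>p. open (U p)" "\<And>p. p \<in> U p"
      "\<And>p u l. u \<in> T (i p) \<Longrightarrow> l \<in> L \<Longrightarrow> u + l \<notin> U p"
    by metis
  have L: "0 \<in> L" "\<And>a b. a \<in> L \<Longrightarrow> b \<in> L \<Longrightarrow> a + b \<in> L" "\<And>a. a \<in> L \<Longrightarrow> - a \<in> L"
    using assms unfolding lattice_subgroup_def by auto
  let ?R = "coset_rel L"
  have coset_eq: "?R `` {a} = ?R `` {b} \<longleftrightarrow> a - b \<in> L" for a b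
  proof
    assume "?R `` {a} = ?R `` {b}"
    moreover have "b \<in> ?R `` {b}"
      using L by (simp add: coset_rel_def)
    ultimately show "a - b \<in> L"
      by (auto simp: coset_rel_def)
  next
    assume ab: "a - b \<in> L"
    have "a - c \<in> L \<longleftrightarrow> b - c \<in> L" for c
      using L(2)[OF ab, of "b - c"] L(2)[OF L(3)[OF ab], of "a - c"] by auto
    then show "?R `` {a} = ?R `` {b}"
      by (auto simp: coset_rel_def)
  qed
  define Q where "Q = (\<lambda>p. (\<lambda>a. ?R `` {a}) ` U p)"
  have "openin (quotient_topology ?R) (Q p)" for p
  proof -
    \<comment> \<open>The projection to the quotient is open: the saturation of \<open>U p\<close>
      is a union of translates of \<open>U p\<close>.\<close>
    have "{a. ?R `` {a} \<in> Q p} = (\<Union>l\<in>L. (\<lambda>a. a - l) -` U p)"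
    proof (intro set_eqI iffI)
      fix a assume "a \<in> {a. ?R `` {a} \<in> Q p}"
      then obtain q where "q \<in> U p" "a - q \<in> L"
        by (auto simp: Q_def coset_eq)
      then show "a \<in> (\<Union>l\<in>L. (\<lambda>a. a - l) -` U p)"
        by (intro UN_I[of "a - q"]) auto
    next
      fix a assume "a \<in> (\<Union>l\<in>L. (\<lambda>a. a - l) -` U p)"
      then obtain l where "l \<in> L" "a - l \<in> U p"
        by auto
      moreover from this have "?R `` {a} = ?R `` {a - l}"
        by (simp add: coset_eq)
      ultimately show "a \<in> {a. ?R `` {a} \<in> Q p}"
        unfolding Q_def by blast
    qed
    moreover have "open ((\<lambda>a. a - l) -` U p)" for l
      by (intro open_vimage iU continuous_intros)
    ultimately show ?thesis
      by (auto simp: openin_quotient_topology Q_def quotient_def)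
  qed
  moreover have "UNIV // ?R \<subseteq> \<Union>(range Q)"
    using iU(3) by (fastforce simp: quotient_def Q_def)
  ultimately obtain \<F> where \<F>: "finite \<F>" "\<F> \<subseteq> range Q" "UNIV // ?R \<subseteq> \<Union>\<F>"
    using assms unfolding lattice_subgroup_def compact_space_alt topspace_quotient_topology
    by (metis (no_types, lifting) imageE)
  then obtain P where P: "finite P" "\<F> = Q ` P"
    by (meson finite_subset_image)
  \<comment> \<open>A common point \<open>u\<close> of the finitely many sets belonging to the
    subcover has its class in some \<open>Q p\<close>, against the choice of
    \<open>U p\<close>.\<close>
  have "(\<Inter>j\<in>i ` P. T j) \<noteq> {}"
    using P iU(1) by (intro fip) auto
  then obtain u where u: "\<And>p. p \<in> P \<Longrightarrow> u \<in> T (i p)"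
    by auto
  have "?R `` {u} \<in> \<Union>(Q ` P)"
    using \<F>(3) P(2) by (auto simp: quotient_def)
  then obtain p q where p: "p \<in> P" "q \<in> U p" "u - q \<in> L"
    by (auto simp: Q_def coset_eq)
  then show False
    using iU(4)[OF u, of p "- (u - q)"] L(3)[of "u - q"] by simp
qed

section \<open>Separation from a translated model set\<close>

lemma mem_translate_cps_set:
  fixes L :: "('g::ab_group_add \<times> 'h::ab_group_add) set"
  shows "y \<in> (+) a ` cps_set L ((+) (- b) ` W) \<longleftrightarrow> (\<exists>w\<in>W. (y - a, w - b) \<in> L)"
proof
  assume "y \<in> (+) a ` cps_set L ((+) (- b) ` W)"
  then show "\<exists>w\<in>W. (y - a, w - b) \<in> L"
    by (auto simp: cps_set_def)
next
  assume "\<exists>w\<in>W. (y - a, w - b) \<in> L"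
  then have "y - a \<in> cps_set L ((+) (- b) ` W)"
    by (auto simp: cps_set_def)
  then show "y \<in> (+) a ` cps_set L ((+) (- b) ` W)"
    by (intro image_eqI[of _ _ "y - a"]) auto
qed

text \<open>The triple \<open>(y, a, b)\<close> together with any \<open>w \<in> W\<close> is mapped
  by differences into the open complement of \<open>L\<close>. Compactness of \<open>W\<close> and
  the tube lemma give neighbourhoods that work for all \<open>w\<close> at once.\<close>

lemma cps_set_separation:
  fixes L :: "('g::topological_ab_group_add \<times> 'h::topological_ab_group_add) set"
  assumes "closed L" "compact W" "y \<notin> (+) a ` cps_set L ((+) (- b) ` W)"
  obtains A U V where "open A" "y \<in> A" "open U" "a \<in> U" "open V" "b \<in> V"
    "\<And>x u v w. x \<in> A \<Longrightarrow> u \<in> U \<Longrightarrow> v \<in> V \<Longrightarrow> w \<in> W \<Longrightarrow> (x - u, w - v) \<notin> L"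
proof -
  define \<phi> :: "('g \<times> 'g \<times> 'h) \<times> 'h \<Rightarrow> 'g \<times> 'h"
    where "\<phi> = (\<lambda>p. (fst (fst p) - fst (snd (fst p)), snd p - snd (snd (fst p))))"
  have "continuous_on UNIV \<phi>"
    unfolding \<phi>_def by (intro continuous_intros)
  then have op: "open (\<phi> -` (- L))"
    using assms(1) by (intro open_vimage) auto
  have sub: "{(y, a, b)} \<times> W \<subseteq> \<phi> -` (- L)"
    using assms(3)[unfolded mem_translate_cps_set] by (auto simp: \<phi>_def)
  obtain X where X: "(y, a, b) \<in> X" "open X" "X \<times> W \<subseteq> \<phi> -` (- L)"
    using Elementary_Topology.tube_lemma[OF assms(2) op sub] by blast
  obtain A Y where Y: "open A" "open Y" "(y, a, b) \<in> A \<times> Y" "A \<times> Y \<subseteq> X"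
    using open_prod_elim[OF X(2,1)] by blast
  then have "(a, b) \<in> Y"
    by auto
  obtain U V where UV: "open U" "open V" "(a, b) \<in> U \<times> V" "U \<times> V \<subseteq> Y"
    using open_prod_elim[OF Y(2) \<open>(a, b) \<in> Y\<close>] by blast
  have "(x - u, w - v) \<notin> L" if "x \<in> A" "u \<in> U" "v \<in> V" "w \<in> W" for x u v w
  proof -
    have "((x, u, v), w) \<in> \<phi> -` (- L)"
      using that Y(4) UV(4) X(3) by blast
    then show ?thesis
      by (simp add: \<phi>_def)
  qed
  then show thesis
    using Y UV by (intro that[of A U V]) auto
qed

section \<open>Test functions and almost periodicity\<close>

text \<open>Serves for reflections and translations: the support of the composition is a closed
  subset of the compact set \<open>q\<close> applied to \<open>csupp f\<close>.\<close>

lemma Cc_compose: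
  fixes f :: "'g::topological_space \<Rightarrow> 'b::{zero, topological_space}"
  assumes "f \<in> Cc" "continuous_on UNIV p" "continuous_on UNIV q"
    and "\<And>x. p (q x) = x" "\<And>x. q (p x) = x"
  shows "(\<lambda>x. f (p x)) \<in> Cc"
proof -
  have cf: "continuous_on UNIV f" and cs: "compact (csupp f)"
    using assms(1) by (auto simp: Cc_def)
  have "continuous_on UNIV (\<lambda>x. f (p x))"
    using continuous_on_compose2[OF cf assms(2)] by simp
  moreover have "csupp (\<lambda>x. f (p x)) \<subseteq> p -` csupp f"
    unfolding csupp_def
    by (intro closure_minimal closed_vimage assms) (use closure_subset in fastforce)+
  moreover have "p -` csupp f = q ` csupp f"
    using assms(4,5) by (auto simp: image_iff) metis
  moreover have "compact (q ` csupp f)"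
    using cs assms(3) by (meson compact_continuous_image continuous_on_subset subset_UNIV)
  moreover have "closed (csupp (\<lambda>x. f (p x)))"
    by (simp add: csupp_def)
  ultimately show ?thesis
    unfolding Cc_def by (metis (mono_tags, lifting) compact_Int_closed inf.absorb2 mem_Collect_eq)
qed

lemma translates_subset_Cu:
  assumes "f \<in> apply_bcontfun ` Cu"
  shows "translates f \<subseteq> Cu"
proof
  fix F assume "F \<in> translates f"
  then obtain t where t: "\<And>x. apply_bcontfun F x = f (x - t)"
    by (auto simp: translates_def translate_def fun_eq_iff)
  obtain G where G: "G \<in> Cu" "\<And>x. f x = apply_bcontfun G x"
    using assms by auto
  have "\<forall>\<^sub>F y in nhds 0. \<forall>x. norm (apply_bcontfun F (x + y) - apply_bcontfun F x) < e" if "e > 0" for e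
  proof -
    have "\<forall>\<^sub>F y in nhds 0. \<forall>x. norm (apply_bcontfun G (x + y) - apply_bcontfun G x) < e"
      using G that by (auto simp: Cu_def)
    then show ?thesis
    proof eventually_elim
      case (elim y)
      show ?case
        using elim[rule_format, of "_ - t"] by (simp add: t G(2) algebra_simps)
    qed
  qed
  then show "F \<in> Cu"
    by (auto simp: Cu_def)
qed

text \<open>\<open>translates f\<close> collects bounded continuous functions only, so each
  translate must first be shown to be one.\<close>

lemma translate_mem_translates:
  fixes f :: "'g::topological_ab_group_add \<Rightarrow> complex"
  assumes "f \<in> apply_bcontfun ` Cu"
  shows "\<exists>F\<in>translates f. \<forall>x. apply_bcontfun F x = f (x - t)"
proof -
  obtain G where G: "f = apply_bcontfun G"
    using assms by auto
  have "(\<lambda>x. f (x - t)) \<in> bcontfun"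
    unfolding bcontfun_def G
  proof (intro CollectI conjI)
    show "continuous_on UNIV (\<lambda>x. apply_bcontfun G (x - t))"
      by (rule continuous_on_compose2[OF continuous_on_apply_bcontfun[of UNIV]])
        (auto intro!: continuous_intros)
    show "bounded (range (\<lambda>x. apply_bcontfun G (x - t)))"
      by (rule bounded_subset[OF bounded_apply_bcontfun[of G]]) auto
  qed
  then obtain F where F: "(\<lambda>x. f (x - t)) = apply_bcontfun F"
    by (rule bcontfunE)
  then have "F \<in> translates f"
    unfolding translates_def translate_def by (metis (mono_tags, lifting) mem_Collect_eq)
  with F show ?thesis
    by (metis (mono_tags))
qed

text \<open>The compact norm closure of the translates is covered by finitely many
  \<open>e\<close>-balls. Their centres appear as plain functions \<open>k\<close>.\<close>

lemma bohr_ap_totally_bounded: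
  fixes g :: "'g::topological_ab_group_add \<Rightarrow> complex"
  assumes "bohr_ap g" "e > 0"
  shows "\<exists>K. finite K \<and> (\<forall>t. \<exists>k\<in>K. \<forall>x. norm (g (x - t) - k x) < e)"
proof -
  define C where "C = top_of_set Cu closure_of translates g"
  have g: "g \<in> apply_bcontfun ` Cu" and C: "compact C"
    using assms(1) by (auto simp: bohr_ap_def precompact_in_def Cu_norm_topology_def C_def
        compactin_subtopology)
  have sub: "translates g \<subseteq> C"
    unfolding C_def using translates_subset_Cu[OF g] by (intro closure_of_subset) auto
  obtain K where K: "finite K" "C \<subseteq> (\<Union>k\<in>K. ball k e)"
    by (rule compactE_image[OF C, of C "\<lambda>k. ball k e"]) (use assms(2) in auto)
  have "\<exists>k\<in>apply_bcontfun ` K. \<forall>x. norm (g (x - t) - k x) < e" for t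
  proof -
    obtain F where F: "F \<in> translates g" "\<And>x. apply_bcontfun F x = g (x - t)"
      using translate_mem_translates[OF g] by metis
    then obtain k where k: "k \<in> K" "dist F k < e"
      using sub K(2) by (auto simp: dist_commute)
    have "norm (g (x - t) - apply_bcontfun k x) < e" for x
      using dist_fun_lt_imp_dist_val_lt[OF k(2), of x] by (simp add: F dist_norm)
    with k show ?thesis
      by auto
  qed
  with K(1) show ?thesis
    by (intro exI[of _ "apply_bcontfun ` K"]) auto
qed

text \<open>Classify each \<open>t\<close> by the net elements chosen for its translates, one for
  each \<open>j\<close>. There are finitely many classes, and \<open>R\<close> takes one
  representative of each.\<close>

lemma bohr_ap_common_almost_periods:
  fixes g :: "'i \<Rightarrow> 'g::topological_ab_group_add \<Rightarrow> complex"
  assumes "finite J" "\<And>j. j \<in> J \<Longrightarrow> bohr_ap (g j)" "e > 0"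
  obtains R where "finite R" "\<And>t. \<exists>r\<in>R. \<forall>j\<in>J. norm (g j (t - r) - g j 0) < e"
proof -
  have "\<forall>j\<in>J. \<exists>K. finite K \<and> (\<forall>t. \<exists>k\<in>K. \<forall>x. norm (g j (x - t) - k x) < e / 2)"
    using assms by (intro ballI bohr_ap_totally_bounded) auto
  then obtain K where K: "\<And>j. j \<in> J \<Longrightarrow> finite (K j)"
      "\<And>j t. j \<in> J \<Longrightarrow> \<exists>k\<in>K j. \<forall>x. norm (g j (x - t) - k x) < e / 2"
    by metis
  then obtain k where k: "\<And>j t. j \<in> J \<Longrightarrow> k j t \<in> K j"
      "\<And>j t x. j \<in> J \<Longrightarrow> norm (g j (x - t) - k j t x) < e / 2"
    by metis
  \<comment> \<open>Two points with the same \<open>\<phi>\<close>-value differ by a common \<open>e\<close>-almost period.\<close>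
  define \<phi> where "\<phi> = (\<lambda>t. \<lambda>j\<in>J. k j t)"
  have "range \<phi> \<subseteq> PiE J K"
    using k(1) by (auto simp: \<phi>_def)
  then have "finite (range \<phi>)"
    using finite_PiE[OF assms(1)] K(1) by (metis finite_subset)
  show thesis
  proof (rule that)
    show "finite (inv \<phi> ` range \<phi>)"
      using \<open>finite (range \<phi>)\<close> by simp
    fix t
    define r where "r = inv \<phi> (\<phi> t)"
    have "\<phi> r = \<phi> t"
      by (simp add: r_def f_inv_into_f)
    have "norm (g j (t - r) - g j 0) < e" if "j \<in> J" for j
    proof -
      have "k j r = k j t"
        using fun_cong[OF \<open>\<phi> r = \<phi> t\<close>, of j] that by (simp add: \<phi>_def)
      \<comment> \<open>At the point \<open>t\<close>, the translates by \<open>r\<close> and by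
        \<open>t\<close> take the values \<open>g j (t - r)\<close> and \<open>g j 0\<close>, both
        within \<open>e / 2\<close> of \<open>k j t t\<close>.\<close>
      then show ?thesis
        using k(2)[OF that, of t r] k(2)[OF that, of t t]
          norm_triangle_ineq4[of "g j (t - r) - k j t t" "g j 0 - k j t t"]
        by simp
    qed
    then show "\<exists>r\<in>inv \<phi> ` range \<phi>. \<forall>j\<in>J. norm (g j (t - r) - g j 0) < e"
      by (auto simp: r_def)
  qed
qed

section \<open>Haar measure and means\<close>

lemma haar_measure_distr:
  assumes "haar_measure \<theta>"
  shows "distr \<theta> \<theta> ((+) x) = \<theta>"
proof -
  have sets: "sets \<theta> = sets borel"
    and inv: "\<And>y B. B \<in> sets borel \<Longrightarrow> emeasure \<theta> ((+) y ` B) = emeasure \<theta> B"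
    using assms by (auto simp: haar_measure_def)
  have meas: "(+) x \<in> measurable \<theta> \<theta>"
    unfolding measurable_cong_sets[OF sets sets]
    by (intro borel_measurable_continuous_onI continuous_intros)
  show ?thesis
  proof (rule measure_eqI)
    fix B assume B: "B \<in> sets (distr \<theta> \<theta> ((+) x))"
    have "(+) x -` B \<inter> space \<theta> = (+) (- x) ` B"
      using sets_eq_imp_space_eq[OF sets] by (force simp: image_iff)
    with B meas show "emeasure (distr \<theta> \<theta> ((+) x)) B = emeasure \<theta> B"
      by (simp add: emeasure_distr inv sets del: uminus_add_conv_diff)
  qed simp
qed

text \<open>The mean is uniform over the translated averaging sets; the choice
  \<open>x = - r\<close> and invariance of \<open>\<theta>\<close> move the translation from the set
  to the function.\<close>

lemma has_mean_translate:
  fixes f :: "'g::{topological_ab_group_add, t2_space} \<Rightarrow> 'b::{banach, second_countable_topology}"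
  assumes "haar_measure \<theta>" "folner_sequence \<theta> A" "has_mean \<theta> f m" "f \<in> borel_measurable borel"
  shows "(\<lambda>n. (LINT t:A n|\<theta>. f (t - r)) /\<^sub>R measure \<theta> (A n)) \<longlonglongrightarrow> m"
proof -
  have sets: "sets \<theta> = sets borel"
    using assms(1) by (simp add: haar_measure_def)
  have "(LINT t:((+) x ` A n)|\<theta>. f t) = (LINT t:A n|\<theta>. f (x + t))" for x n
  proof -
    let ?B = "(+) x ` A n"
    have "compact ?B"
      using assms(2) by (intro compact_continuous_image continuous_intros) (simp add: folner_sequence_def)
    then have "?B \<in> sets borel"
      by (simp add: compact_imp_closed)
    then have "(\<lambda>t. indicator ?B t *\<^sub>R f t) \<in> borel_measurable borel"
      using assms(4) by simp
    then have meas: "(\<lambda>t. indicator ?B t *\<^sub>R f t) \<in> borel_measurable \<theta>"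
      unfolding measurable_cong_sets[OF sets refl] .
    have "(+) x \<in> measurable \<theta> \<theta>"
      unfolding measurable_cong_sets[OF sets sets]
      by (intro borel_measurable_continuous_onI continuous_intros)
    from integral_distr[OF this meas] show ?thesis
      unfolding set_lebesgue_integral_def haar_measure_distr[OF assms(1)]
      by (simp add: indicator_def image_iff)
  qed
  moreover have "uniform_limit UNIV
      (\<lambda>n x. (LINT t:((+) x ` A n)|\<theta>. f t) /\<^sub>R measure \<theta> (A n)) (\<lambda>_. m) sequentially"
    using assms(2,3) unfolding has_mean_def by blast
  ultimately show ?thesis
    by (fastforce dest: tendsto_uniform_limitI[where x = "- r"])
qed

text \<open>If the functions were never simultaneously small on the syndetic set \<open>P\<close>, a
  finite sum of translates of their absolute values would be at least \<open>e\<close> everywhere,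
  although its averages tend to 0.\<close>

lemma null_mean_small_on_syndetic:
  fixes P R :: "'g::{topological_ab_group_add, t2_space} set"
  assumes "haar_measure \<theta>" "folner_sequence \<theta> A"
    and "finite J" "\<And>j. j \<in> J \<Longrightarrow> null_weakly_ap \<theta> (h j)" "e > 0"
    and "finite R" "\<And>t. \<exists>r\<in>R. t - r \<in> P"
  obtains v where "v \<in> P" "\<And>j. j \<in> J \<Longrightarrow> norm (h j v) < e"
proof (rule ccontr)
  assume "\<not> thesis"
  with that have large: "\<exists>j\<in>J. e \<le> norm (h j v)" if "v \<in> P" for v
    by (meson linorder_not_le that)
  have sets: "sets \<theta> = sets borel" and fin: "\<And>K. compact K \<Longrightarrow> emeasure \<theta> K < \<infinity>"
    using assms(1) by (auto simp: haar_measure_def)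
  have A: "\<And>n. compact (A n)" "\<And>n. measure \<theta> (A n) > 0"
    using assms(2) by (auto simp: folner_sequence_def)
  have A_sets: "A n \<in> sets \<theta>" for n
    using A(1) by (simp add: sets compact_imp_closed)
  have "\<forall>j\<in>J. \<exists>G. h j = apply_bcontfun G"
    using assms(4) by (auto simp: null_weakly_ap_def weakly_ap_def)
  then obtain F where F: "\<And>j. j \<in> J \<Longrightarrow> h j = apply_bcontfun (F j)"
    by metis
  have cont: "continuous_on UNIV (\<lambda>t. norm (h j (t - r)))" if "j \<in> J" for j r
    unfolding F[OF that]
    by (intro continuous_on_norm continuous_on_compose2[OF continuous_on_apply_bcontfun[of UNIV]])
      (auto intro!: continuous_intros)
  have int: "set_integrable \<theta> (A n) (\<lambda>t. norm (h j (t - r)))" if j: "j \<in> J" for j r n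
  proof -
    obtain B where "\<And>t. norm (h j t) \<le> B"
      using bounded_apply_bcontfun[of "F j"] by (auto simp: F[OF j] bounded_iff)
    moreover have "(\<lambda>t. norm (h j (t - r))) \<in> borel_measurable \<theta>"
      unfolding measurable_cong_sets[OF sets refl]
      using cont[OF j] by (rule borel_measurable_continuous_onI)
    ultimately show ?thesis
      unfolding set_integrable_def using A_sets fin[OF A(1)]
      by (intro integrableI_bounded_set_indicator[of _ _ _ B]) auto
  qed
  \<comment> \<open>Summing over the translates by \<open>R\<close> makes the lower bound on \<open>P\<close> a lower bound on the whole group.\<close>
  define s where "s = (\<lambda>n. \<Sum>r\<in>R. \<Sum>j\<in>J. (LINT t:A n|\<theta>. norm (h j (t - r))) /\<^sub>R measure \<theta> (A n))"
  have "s \<longlonglongrightarrow> (\<Sum>r\<in>R. \<Sum>j\<in>J. 0)"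
    unfolding s_def
  proof (intro tendsto_sum has_mean_translate[OF assms(1,2)])
    fix j assume "j \<in> J"
    then show "has_mean \<theta> (\<lambda>t. norm (h j t)) 0"
      using assms(4) by (simp add: null_weakly_ap_def)
    show "(\<lambda>t. norm (h j t)) \<in> borel_measurable borel"
      using cont[OF \<open>j \<in> J\<close>, of 0] by (intro borel_measurable_continuous_onI) simp
  qed
  then have "s \<longlonglongrightarrow> 0"
    by simp
  moreover have "e \<le> s n" for n
  proof -
    have pw: "e \<le> (\<Sum>r\<in>R. \<Sum>j\<in>J. norm (h j (t - r)))" for t
    proof -
      obtain r j where rj: "r \<in> R" "j \<in> J" "e \<le> norm (h j (t - r))"
        using assms(7) large by blast
      note rj(3)
      also have "norm (h j (t - r)) \<le> (\<Sum>j\<in>J. norm (h j (t - r)))"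
        using rj assms(3) by (intro member_le_sum) auto
      also have "\<dots> \<le> (\<Sum>r\<in>R. \<Sum>j\<in>J. norm (h j (t - r)))"
        using rj assms(6) by (intro member_le_sum[of r R "\<lambda>r. \<Sum>j\<in>J. norm (h j (t - r))"])
          (auto intro: sum_nonneg)
      finally show ?thesis .
    qed
    have sum_int: "set_integrable \<theta> (A n) (\<lambda>t. \<Sum>r\<in>R. \<Sum>j\<in>J. norm (h j (t - r)))"
      unfolding set_integrable_def scaleR_sum_right
      by (intro Bochner_Integration.integrable_sum int[unfolded set_integrable_def])
    have const_int: "set_integrable \<theta> (A n) (\<lambda>_. e)"
      using A_sets fin[OF A(1)] unfolding set_integrable_def by (intro integrable_indicator)
    have "e * measure \<theta> (A n) = (LINT t:A n|\<theta>. e)"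
      using A_sets fin[OF A(1)] by (simp add: set_lebesgue_integral_def less_top)
    also have "\<dots> \<le> (LINT t:A n|\<theta>. (\<Sum>r\<in>R. \<Sum>j\<in>J. norm (h j (t - r))))"
      by (rule set_integral_mono[OF const_int sum_int pw])
    also have "\<dots> = (\<Sum>r\<in>R. \<Sum>j\<in>J. (LINT t:A n|\<theta>. norm (h j (t - r))))"
      using int unfolding set_integrable_def set_lebesgue_integral_def scaleR_sum_right
      by (simp add: Bochner_Integration.integral_sum)
    also have "\<dots> = s n * measure \<theta> (A n)"
      unfolding s_def sum_distrib_right using A(2)[of n]
      by (intro sum.cong refl) (simp add: field_simps)
    finally show ?thesis
      using A(2)[of n] by simp
  qed
  ultimately have "e \<le> 0"
    by (intro LIMSEQ_le_const) auto
  with assms(5) show False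
    by simp
qed

section \<open>Approximating the strongly almost periodic part by translates\<close>

text \<open>Choose \<open>v\<close> as a common \<open>e / 2\<close>-almost period, relative to 0,
  of the convolutions with \<open>\<mu>s\<close>, at which those with \<open>\<mu>0\<close> are
  below \<open>e / 2\<close>; then \<open>u = - v\<close> works.\<close>

lemma eberlein_translates_approximate:
  fixes \<mu> \<mu>s \<mu>0 :: "'g::{topological_ab_group_add, t2_space} msr"
  assumes "haar_measure \<theta>" "folner_sequence \<theta> A" "eberlein_decomposition \<theta> \<mu> \<mu>s \<mu>0"
    and "finite F" "F \<subseteq> Cc" "e > 0"
  obtains u where "\<And>f. f \<in> F \<Longrightarrow> norm (\<mu> (\<lambda>x. f (x + u)) - \<mu>s f) < e"
proof -
  \<comment> \<open>Reflecting \<open>f\<close> cancels the reflection in the convolution: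
    \<open>conv_measure (c f) \<nu> v\<close> is \<open>\<nu>\<close> tested on a translate of
    \<open>f\<close>, and on \<open>f\<close> itself for \<open>v = 0\<close>.\<close>
  define c :: "('g \<Rightarrow> complex) \<Rightarrow> 'g \<Rightarrow> complex" where "c = (\<lambda>f x. f (- x))"
  have c: "c f \<in> Cc" if "f \<in> F" for f
    unfolding c_def using that assms(5)
    by (intro Cc_compose[of f uminus uminus]) (auto intro!: continuous_intros)
  have conv: "conv_measure (c f) \<nu> v = \<nu> (\<lambda>x. f (x + - v))" for f v and \<nu> :: "'g msr"
    by (simp add: conv_measure_def c_def)
  obtain R where R: "finite R"
      "\<And>t. \<exists>r\<in>R. \<forall>f\<in>F. norm (conv_measure (c f) \<mu>s (t - r) - conv_measure (c f) \<mu>s 0) < e / 2"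
    using assms(3) c \<open>e > 0\<close>
    by (auto simp: eberlein_decomposition_def SAP_def
        intro: bohr_ap_common_almost_periods[OF assms(4), of "\<lambda>f. conv_measure (c f) \<mu>s" "e / 2"])
  obtain v where v: "\<forall>f\<in>F. norm (conv_measure (c f) \<mu>s v - conv_measure (c f) \<mu>s 0) < e / 2"
      "\<And>f. f \<in> F \<Longrightarrow> norm (conv_measure (c f) \<mu>0 v) < e / 2"
  proof (rule null_mean_small_on_syndetic[OF assms(1,2,4), where e = "e / 2" and R = R
        and h = "\<lambda>f. conv_measure (c f) \<mu>0"
        and P = "{v. \<forall>f\<in>F. norm (conv_measure (c f) \<mu>s v - conv_measure (c f) \<mu>s 0) < e / 2}"])
    show "null_weakly_ap \<theta> (conv_measure (c f) \<mu>0)" if "f \<in> F" for f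
      using assms(3) c[OF that] by (simp add: eberlein_decomposition_def WAP0_def)
  qed (use R \<open>e > 0\<close> in auto)
  show thesis
  proof (rule that[of "- v"])
    fix f assume f: "f \<in> F"
    have "(\<lambda>x. f (x + - v)) \<in> Cc"
      using f assms(5)
      by (intro Cc_compose[of f "\<lambda>x. x + - v" "\<lambda>x. x + v"] continuous_intros) auto
    then have "\<mu> (\<lambda>x. f (x + - v)) = conv_measure (c f) \<mu>s v + conv_measure (c f) \<mu>0 v"
      using assms(3) unfolding conv eberlein_decomposition_def by blast
    moreover have "\<mu>s f = conv_measure (c f) \<mu>s 0"
      unfolding conv by simp
    ultimately have "\<mu> (\<lambda>x. f (x + - v)) - \<mu>s f
        = (conv_measure (c f) \<mu>s v - conv_measure (c f) \<mu>s 0) + conv_measure (c f) \<mu>0 v"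
      by simp
    then show "norm (\<mu> (\<lambda>x. f (x + - v)) - \<mu>s f) < e"
      using v(1)[rule_format, OF f] v(2)[OF f]
        norm_triangle_ineq[of "conv_measure (c f) \<mu>s v - conv_measure (c f) \<mu>s 0"
          "conv_measure (c f) \<mu>0 v"]
      by simp
  qed
qed

section \<open>Supports of the two components\<close>

lemma weighted_dirac_comb_eq_0:
  assumes "\<And>x. x \<in> S \<Longrightarrow> f x = 0"
  shows "weighted_dirac_comb \<omega> S f = 0"
  unfolding weighted_dirac_comb_def using assms by (intro infsum_0) simp

lemma supp_measure_subsetI:
  assumes "\<And>y. y \<notin> S \<Longrightarrow> \<exists>U. open U \<and> y \<in> U \<and> (\<forall>f\<in>Cc. csupp f \<subseteq> U \<longrightarrow> \<mu> f = 0)"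
  shows "supp_measure \<mu> \<subseteq> S"
  using assms by (fastforce simp: supp_measure_def)

theorem theorem6p12:
  fixes L :: "('g::{topological_ab_group_add, t2_space} \<times> 'h::{topological_ab_group_add, t2_space}) set"
    and W :: "'h set"
    and \<omega> :: "'g \<Rightarrow> complex"
    and \<theta> :: "'g measure"
    and \<mu> \<mu>s \<mu>0 :: "'g msr"
  assumes "cut_and_project_scheme L"
    and "haar_measure \<theta>"
    and "\<exists>A. folner_sequence \<theta> A"
    and "compact W"
    and "\<mu> = weighted_dirac_comb \<omega> (cps_set L W)"
    and "\<mu> \<in> WAP"
    and "eberlein_decomposition \<theta> \<mu> \<mu>s \<mu>0"
  shows "\<exists>s t. supp_measure \<mu>s \<subseteq> (+) s ` cps_set L ((+) t ` W) \<and>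
               supp_measure \<mu>0 \<subseteq> ((+) s ` cps_set L ((+) t ` W)) \<union> cps_set L W"
proof -
  have lat: "lattice_subgroup L"
    using assms(1) by (simp add: cut_and_project_scheme_def)
  then have cl: "closed L"
    by (rule closed_discrete_subgroup)
  have diffL: "p - q \<in> L" if "p \<in> L" "q \<in> L" for p q
    using lat that unfolding lattice_subgroup_def by (metis diff_conv_add_uminus)
  obtain A where A: "folner_sequence \<theta> A"
    using assms(3) by blast
  \<comment> \<open>An index \<open>(f, e)\<close> prescribes a test function and a tolerance. The
    parameters \<open>u\<close> are embedded as \<open>(u, 0)\<close> because it is the product
    group modulo \<open>L\<close> that is compact.\<close>
  define T where "T = (\<lambda>(f, e). {(u, 0::'h) | u. norm (\<mu> (\<lambda>x. f (x + u)) - \<mu>s f) < e})"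
  have fip: "(\<Inter>j\<in>J. T j) \<noteq> {}" if J: "finite J" "J \<subseteq> Cc \<times> {0<..}" for J
  proof -
    \<comment> \<open>The smallest tolerance in \<open>J\<close>; the inserted 1 keeps the minimum
      meaningful for empty \<open>J\<close>.\<close>
    define d where "d = Min (insert 1 (snd ` J))"
    have "d > 0"
      using J by (auto simp: d_def)
    moreover have "finite (fst ` J)" "fst ` J \<subseteq> Cc"
      using J by auto
    ultimately obtain u where u: "\<And>f. f \<in> fst ` J \<Longrightarrow> norm (\<mu> (\<lambda>x. f (x + u)) - \<mu>s f) < d"
      using eberlein_translates_approximate[OF assms(2) A assms(7)] by metis
    have "(u, 0) \<in> T j" if "j \<in> J" for j
    proof -
      have "d \<le> snd j"
        using that J by (auto simp: d_def)
      with u[of "fst j"] that show ?thesis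
        by (auto simp: T_def case_prod_beta)
    qed
    then show ?thesis
      by blast
  qed
  obtain p where p: "\<And>i U. i \<in> Cc \<times> {0<..} \<Longrightarrow> open U \<Longrightarrow> p \<in> U \<Longrightarrow> \<exists>u\<in>T i. \<exists>l\<in>L. u + l \<in> U"
    using cocompact_cluster_point[OF lat, of "Cc \<times> {0<..}" T] fip by blast
  obtain a b where ab: "p = (a, b)"
    by force
  \<comment> \<open>This fixes the witnesses \<open>s = a\<close> and \<open>t = - b\<close>: a
    point \<open>y\<close> belongs to \<open>?S\<close> when \<open>(y - a, w - b) \<in> L\<close>
    for some \<open>w \<in> W\<close>.\<close>
  let ?S = "(+) a ` cps_set L ((+) (- b) ` W)"
  have \<mu>s: "\<exists>N. open N \<and> y \<in> N \<and> (\<forall>f\<in>Cc. csupp f \<subseteq> N \<longrightarrow> \<mu>s f = 0)" if y: "y \<notin> ?S" for y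
  proof -
    obtain N U V where N: "open N" "y \<in> N" and UV: "open U" "a \<in> U" "open V" "b \<in> V"
      and sep: "\<And>x u v w. x \<in> N \<Longrightarrow> u \<in> U \<Longrightarrow> v \<in> V \<Longrightarrow> w \<in> W \<Longrightarrow> (x - u, w - v) \<notin> L"
      by (rule cps_set_separation[OF cl assms(4) y]) (rule that, assumption+)
    have "\<mu>s f = 0" if f: "f \<in> Cc" "csupp f \<subseteq> N" for f
    proof -
      \<comment> \<open>Some translate of \<open>\<mu>\<close> that is \<open>e\<close>-close to \<open>\<mu>s\<close> on \<open>f\<close> has no mass on \<open>N\<close>.\<close>
      have "norm (\<mu>s f) < e" if "e > 0" for e
      proof -
        \<comment> \<open>The cluster property at \<open>p\<close> yields a good parameter
          \<open>u\<close> and a lattice point \<open>(l, l')\<close> with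
          \<open>(u + l, l')\<close> close to \<open>(a, b)\<close>.\<close>
        have "\<exists>q\<in>T (f, e). \<exists>l\<in>L. q + l \<in> U \<times> V"
          using f that UV ab by (intro p open_Times) auto
        then obtain u l l' where u: "norm (\<mu> (\<lambda>x. f (x + u)) - \<mu>s f) < e"
            and l: "(l, l') \<in> L" "u + l \<in> U" "l' \<in> V"
          by (auto simp: T_def)
        have "f (x + u) = 0" if x: "x \<in> cps_set L W" for x
        proof (rule ccontr)
          assume "f (x + u) \<noteq> 0"
          then have "x + u \<in> N"
            using f(2) closure_subset[of "{x. f x \<noteq> 0}"] by (auto simp: csupp_def)
          obtain w where w: "w \<in> W" "(x, w) \<in> L"
            using x by (auto simp: cps_set_def)
          \<comment> \<open>Since \<open>x - l = (x + u) - (u + l)\<close>, this lattice point is of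
            the form excluded by the separation.\<close>
          have "(x - l, w - l') \<in> L"
            using diffL[OF w(2) l(1)] by simp
          moreover have "x + u - (u + l) = x - l"
            by simp
          ultimately show False
            using sep[OF \<open>x + u \<in> N\<close> l(2,3) w(1)] by simp
        qed
        then have "\<mu> (\<lambda>x. f (x + u)) = 0"
          unfolding assms(5) by (rule weighted_dirac_comb_eq_0)
        with u show ?thesis
          by simp
      qed
      then show ?thesis
        by (metis less_irrefl zero_less_norm_iff)
    qed
    with N show ?thesis
      by blast
  qed
  have \<mu>0: "\<exists>N. open N \<and> y \<in> N \<and> (\<forall>f\<in>Cc. csupp f \<subseteq> N \<longrightarrow> \<mu>0 f = 0)"
    if y: "y \<notin> ?S \<union> cps_set L W" for y
  proof -
    have "y \<notin> ?S"
      using y by blast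
    then obtain N where N: "open N" "y \<in> N" "\<And>f. f \<in> Cc \<Longrightarrow> csupp f \<subseteq> N \<Longrightarrow> \<mu>s f = 0"
      using \<mu>s[of y] by metis
    \<comment> \<open>Separation at \<open>a = 0\<close>, \<open>b = 0\<close> shows that
      \<open>cps_set L W\<close> is closed: \<open>y\<close> has a neighbourhood \<open>N'\<close>
      disjoint from it.\<close>
    have "y \<notin> (+) 0 ` cps_set L ((+) (- 0) ` W)"
      using y by simp
    then obtain N' U V where N': "open N'" "y \<in> N'" "0 \<in> U" "0 \<in> V"
      and sep: "\<And>x u v w. x \<in> N' \<Longrightarrow> u \<in> U \<Longrightarrow> v \<in> V \<Longrightarrow> w \<in> W \<Longrightarrow> (x - u, w - v) \<notin> L"
      by (rule cps_set_separation[OF cl assms(4)]) (rule that, assumption+)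
    have disj: "x \<notin> N'" if "x \<in> cps_set L W" for x
      using that sep[of x 0 0] N' by (auto simp: cps_set_def)
    \<comment> \<open>For \<open>f\<close> supported in \<open>N \<inter> N'\<close> both
      \<open>\<mu> f\<close> and \<open>\<mu>s f\<close> vanish, hence so does their difference
      \<open>\<mu>0 f\<close>.\<close>
    have "\<mu>0 f = 0" if f: "f \<in> Cc" "csupp f \<subseteq> N \<inter> N'" for f
    proof -
      have "f x = 0" if "x \<in> cps_set L W" for x
        using disj[OF that] f(2) closure_subset[of "{x. f x \<noteq> 0}"] by (auto simp: csupp_def)
      then have "\<mu> f = 0"
        unfolding assms(5) by (rule weighted_dirac_comb_eq_0)
      moreover have "\<mu> f = \<mu>s f + \<mu>0 f"
        using assms(7) f by (simp add: eberlein_decomposition_def)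
      ultimately show ?thesis
        using N(3) f by simp
    qed
    then show ?thesis
      using N N' by (intro exI[of _ "N \<inter> N'"]) auto
  qed
  from \<mu>s \<mu>0 show ?thesis
    by (intro exI[of _ a] exI[of _ "- b"] conjI supp_measure_subsetI)
qed

end
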